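(* Let $\mathcal{H}$ and $\mathcal{K}$ be real or complex Hilbert spaces, let $S$ be a linear operator from $\mathcal{H}$ to $\mathcal{K}$ and $T$ a linear operator from $\mathcal{K}$ to $\mathcal{H}$ (neither assumed densely defined, closed or bounded). The following statements are equivalent: (i) $S$ is densely defined and $S^*=T$. (ii) $S\wedge T$ and $G(S)^{\perp}=W\langle G(T)\rangle$. (iii) $S\wedge T$ and $G(S)^{\perp}\subseteq \operatorname{ran} M_{S,T}$.
   Context: A linear operator from $\mathcal{H}$ to $\mathcal{K}$ is a linear map defined on a linear subspace $\operatorname{dom} S\subseteq\mathcal{H}$ with values in $\mathcal{K}$; equality of operators includes equality of domains. $S\wedge T$ ("$S$ and $T$ are adjoint to each other") means $(Sh\mid k)=(h\mid Tk)$ for all $h\in\operatorname{dom}S$, $k\in\operatorname{dom}T$. $S^*$ is the usual Hilbert space adjoint of a densely defined operator. $G(S)=\{(h,Sh): h\in\operatorname{dom}S\}\subseteq\mathcal{H}\times\mathcal{K}$ is the graph, and $\perp$ is taken in the product Hilbert space $\mathcal{H}\times\mathcal{K}$. $W:\mathcal{K}\times\mathcal{H}\to\mathcal{H}\times\mathcal{K}$ is the flip $W(k,h)=(-h,k)$, and $W\langle\cdot\rangle$ denotes image under $W$. $M_{S,T}$ is the operator in $\mathcal{H}\times\mathcal{K}$ with domain $\operatorname{dom}S\times\operatorname{dom}T$ given by $M_{S,T}(h,k)=(h-Tk,\,Sh+k)$. *)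

theory Defs
  imports "HOL-Analysis.Analysis"
begin

text \<open>
  The scalar field: \<open>\<real>\<close> with trivial conjugation or \<open>\<complex>\<close> with complex conjugation. Up to
  isomorphism there is no other instance, see \<open>rc_scalar_real_or_complex\<close> below.
\<close>

class rc_scalar = real_normed_field +
  fixes scnj :: "'a \<Rightarrow> 'a"
  assumes scnj_add: "scnj (x + y) = scnj x + scnj y"
    and scnj_mult: "scnj (x * y) = scnj x * scnj y"
    and scnj_scnj: "scnj (scnj x) = x"
    and mult_scnj_self_scaleR: "x * scnj x = (norm x)\<^sup>2 *\<^sub>R 1"

instantiation real :: rc_scalar
begin
definition "scnj (x::real) = x"
instance by standard (simp_all add: scnj_real_def power2_eq_square)
end

instantiation complex :: rc_scalar
begin
definition "scnj (z::complex) = cnj z"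
instance
proof
  show "z * scnj z = (norm z)\<^sup>2 *\<^sub>R 1" for z :: complex
    unfolding scnj_complex_def complex_norm_square[symmetric] by (rule of_real_def)
qed (simp_all add: scnj_complex_def)
end

lemma mult_scnj_self: "x * scnj x = of_real ((norm x)\<^sup>2)" for x :: "'a::rc_scalar"
  by (simp add: mult_scnj_self_scaleR of_real_def)

lemma scnj_of_real: "scnj (of_real r :: 'a::rc_scalar) = of_real r"
proof (cases "r = 0")
  case True
  have "scnj (0 + 0 :: 'a) = scnj 0 + scnj 0" by (rule scnj_add)
  then show ?thesis using True by simp
next
  case False
  have "of_real r * scnj (of_real r :: 'a) = of_real r * of_real r"
    by (simp add: mult_scnj_self power2_eq_square)
  then show ?thesis using False by simp
qed

lemma rc_scalar_real_or_complex:
  "(\<forall>x::'a::rc_scalar. \<exists>a. x = of_real a) \<or>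
   (\<exists>i::'a. i * i = -1 \<and> scnj i = - i \<and> (\<forall>x. \<exists>a b. x = of_real a + of_real b * i))"
proof (cases "\<forall>x::'a. \<exists>a. x = of_real a")
  case False
  have cnj_minus: "scnj (- x) = - scnj x" for x :: 'a
    using scnj_mult[of "of_real (-1)" x] by (simp only: scnj_of_real) simp
  have re: "\<exists>r. x + scnj x = of_real r" for x :: 'a
  proof -
    have "(1 + x) * scnj (1 + x) = 1 + (x + scnj x) + x * scnj x"
      using scnj_of_real[of 1, where 'a='a] by (simp add: scnj_add algebra_simps)
    then have "x + scnj x = of_real ((norm (1 + x))\<^sup>2 - 1 - (norm x)\<^sup>2)"
      unfolding mult_scnj_self by (simp add: algebra_simps)
    then show ?thesis by blast
  qed
  have split: "\<exists>a y. x = of_real a + y \<and> scnj y = - y" for x :: 'a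
  proof -
    obtain r where r: "x + scnj x = of_real r" using re[of x] by blast
    define y where "y = x - of_real (r/2)"
    have "scnj y = scnj x - of_real (r/2)"
      unfolding y_def by (simp only: diff_conv_add_uminus scnj_add cnj_minus scnj_of_real)
    also have "\<dots> = - y"
    proof -
      have "of_real r = (of_real (r/2) + of_real (r/2) :: 'a)"
        by (simp only: of_real_add[symmetric]) simp
      then show ?thesis using r unfolding y_def by (simp add: algebra_simps)
    qed
    finally show ?thesis unfolding y_def
      by (intro exI[of _ "r/2"] exI[of _ "x - of_real (r/2)"]) (simp add: y_def)
  qed
  obtain x0 :: 'a where x0: "\<nexists>a. x0 = of_real a" using False by blast
  obtain a0 y where y: "x0 = of_real a0 + y" "scnj y = - y" using split[of x0] by blast
  have y0: "y \<noteq> 0" using x0 y by auto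
  define i where "i = of_real (1 / norm y) * y"
  have ci: "scnj i = - i" unfolding i_def by (simp only: scnj_mult scnj_of_real y) simp
  have ni: "norm i = 1" unfolding i_def using y0 by (simp add: norm_mult del: of_real_divide)
  have ii: "i * i = -1"
  proof -
    have "- (i * i) = 1" using mult_scnj_self[of i] by (simp add: ci ni)
    then show ?thesis by (metis minus_minus)
  qed
  have "\<exists>a b. x = of_real a + of_real b * i" for x :: 'a
  proof -
    obtain a z where z: "x = of_real a + z" "scnj z = - z" using split[of x] by blast
    have "scnj (i * z) = i * z" by (simp add: scnj_mult ci z)
    then obtain r where "i * z + i * z = of_real r" using re[of "i * z"] by auto
    then have "2 * (i * z) = of_real r" by (simp only: mult_2)
    then have "i * z = of_real r / 2"
      by (metis nonzero_mult_div_cancel_left zero_neq_numeral)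
    then have "i * z = of_real (r/2)" by (simp only: of_real_divide of_real_numeral)
    then have "i * i * z = of_real (r/2) * i" by (metis mult.assoc mult.commute)
    then have "- z = of_real (r/2) * i" by (simp only: ii) simp
    then have "z = - (of_real (r/2) * i)" by (metis minus_minus)
    then have "z = of_real (- (r/2)) * i" by (simp only: of_real_minus minus_mult_left)
    then show ?thesis using z by blast
  qed
  then show ?thesis using ii ci by blast
qed simp

text \<open>
  The scalar inner product is linear in its first argument. Topology and completeness are those
  of the ambient norm, which is required to be the one induced by the inner product.
\<close>

locale inner_product_space = vector_space scale
  for scale :: "'s::rc_scalar \<Rightarrow> 'h::real_normed_vector \<Rightarrow> 'h" +
  fixes ip :: "'h \<Rightarrow> 'h \<Rightarrow> 's"
  assumes scale_of_real: "scale (of_real r) x = r *\<^sub>R x"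
    and ip_add_left: "ip (x + y) z = ip x z + ip y z"
    and ip_scale_left: "ip (scale c x) y = c * ip x y"
    and ip_commute: "ip y x = scnj (ip x y)"
    and ip_self: "ip x x = of_real ((norm x)\<^sup>2)"

locale hilbert_space = inner_product_space +
  assumes complete_UNIV: "complete (UNIV :: 'b set)"

lemma hilbert_space_real:
  "hilbert_space (scaleR :: real \<Rightarrow> 'h::{real_inner, complete_space} \<Rightarrow> 'h) inner"
proof unfold_locales
  show "inner y x = scnj (inner x y)" for x y :: 'h
    by (simp add: scnj_real_def inner_commute)
qed (simp_all add: inner_add_left complete_UNIV power2_norm_eq_inner scaleR_add_right scaleR_add_left)

lemma hilbert_space_complex:
  "hilbert_space ((*) :: complex \<Rightarrow> complex \<Rightarrow> complex) (\<lambda>x y. x * cnj y)"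
proof unfold_locales
  show "x * cnj x = of_real ((norm x)\<^sup>2)" for x
    by (rule complex_norm_square[symmetric])
qed (simp_all add: distrib_left distrib_right scnj_complex_def complete_UNIV scaleR_conv_of_real)

definition prod_ip ::
  "('h \<Rightarrow> 'h \<Rightarrow> 's) \<Rightarrow> ('k \<Rightarrow> 'k \<Rightarrow> 's) \<Rightarrow> 'h \<times> 'k \<Rightarrow> 'h \<times> 'k \<Rightarrow> 's::plus" where
  "prod_ip ipH ipK x y = ipH (fst x) (fst y) + ipK (snd x) (snd y)"

lemma hilbert_space_prod:
  assumes "hilbert_space scH ipH" "hilbert_space scK ipK"
  shows "hilbert_space (\<lambda>c (h, k). (scH c h, scK c k)) (prod_ip ipH ipK)"
proof -
  interpret H: hilbert_space scH ipH by fact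
  interpret K: hilbert_space scK ipK by fact
  show ?thesis
  proof unfold_locales
    show "prod_ip ipH ipK y x = scnj (prod_ip ipH ipK x y)" for x y
      using H.ip_commute[of "fst y" "fst x"] K.ip_commute[of "snd y" "snd x"]
      by (simp add: prod_ip_def scnj_add)
    show "complete (UNIV :: ('b \<times> 'c) set)"
      unfolding complete_def
    proof (intro allI impI)
      fix f :: "nat \<Rightarrow> 'b \<times> 'c"
      assume "(\<forall>n. f n \<in> UNIV) \<and> Cauchy f"
      then have "Cauchy (\<lambda>n. fst (f n))" "Cauchy (\<lambda>n. snd (f n))"
        by (auto intro: Cauchy_fst Cauchy_snd)
      then obtain a b where "(\<lambda>n. fst (f n)) \<longlonglongrightarrow> a" "(\<lambda>n. snd (f n)) \<longlonglongrightarrow> b"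
        using H.complete_UNIV K.complete_UNIV unfolding complete_def by blast
      then have "(\<lambda>n. (fst (f n), snd (f n))) \<longlonglongrightarrow> (a, b)" by (rule tendsto_Pair)
      then show "\<exists>l\<in>UNIV. f \<longlonglongrightarrow> l" by auto
    qed
    show "prod_ip ipH ipK (x + y) z = prod_ip ipH ipK x z + prod_ip ipH ipK y z" for x y z
      by (simp add: prod_ip_def H.ip_add_left K.ip_add_left add.assoc add.left_commute)
    show "prod_ip ipH ipK x x = of_real ((norm x)\<^sup>2)" for x
      by (simp add: prod_ip_def norm_prod_def H.ip_self K.ip_self del: of_real_power)
  qed (auto simp: prod_ip_def H.scale_right_distrib H.scale_left_distrib K.scale_right_distrib
      K.scale_left_distrib H.scale_of_real K.scale_of_real
      H.ip_scale_left K.ip_scale_left distrib_left)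
qed

definition orth_compl :: "('h \<Rightarrow> 'h \<Rightarrow> 's::zero) \<Rightarrow> 'h set \<Rightarrow> 'h set" where
  "orth_compl ip A = {x. \<forall>a\<in>A. ip x a = 0}"

text \<open>
  An operator is a partial map \<open>'h \<rightharpoonup> 'k\<close>, so that equality of operators includes equality of
  domains; \<^const>\<open>dom\<close>, \<^const>\<open>ran\<close> and \<^const>\<open>Map.graph\<close> are its domain, range and graph.
\<close>

definition linear_operator ::
  "('s::field \<Rightarrow> 'h::ab_group_add \<Rightarrow> 'h) \<Rightarrow> ('s \<Rightarrow> 'k::ab_group_add \<Rightarrow> 'k) \<Rightarrow> ('h \<rightharpoonup> 'k) \<Rightarrow> bool" where
  "linear_operator scH scK S \<longleftrightarrow>
     module.subspace scH (dom S) \<and>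
     (\<forall>x\<in>dom S. \<forall>y\<in>dom S. the (S (x + y)) = the (S x) + the (S y)) \<and>
     (\<forall>c. \<forall>x\<in>dom S. the (S (scH c x)) = scK c (the (S x)))"

definition densely_defined :: "('h::topological_space \<rightharpoonup> 'k) \<Rightarrow> bool" where
  "densely_defined S \<longleftrightarrow> closure (dom S) = UNIV"

definition adjoint_pair ::
  "('h \<Rightarrow> 'h \<Rightarrow> 's) \<Rightarrow> ('k \<Rightarrow> 'k \<Rightarrow> 's) \<Rightarrow> ('h \<rightharpoonup> 'k) \<Rightarrow> ('k \<rightharpoonup> 'h) \<Rightarrow> bool" where
  "adjoint_pair ipH ipK S T \<longleftrightarrow>
     (\<forall>h\<in>dom S. \<forall>k\<in>dom T. ipK (the (S h)) k = ipH h (the (T k)))"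

text \<open>Meaningful for densely defined \<open>S\<close> only: the representing vector \<open>g\<close> is then unique.\<close>

definition op_adjoint ::
  "('h \<Rightarrow> 'h \<Rightarrow> 's) \<Rightarrow> ('k \<Rightarrow> 'k \<Rightarrow> 's) \<Rightarrow> ('h \<rightharpoonup> 'k) \<Rightarrow> ('k \<rightharpoonup> 'h)" where
  "op_adjoint ipH ipK S = (\<lambda>k.
     if \<exists>g. \<forall>h\<in>dom S. ipK (the (S h)) k = ipH h g
     then Some (THE g. \<forall>h\<in>dom S. ipK (the (S h)) k = ipH h g)
     else None)"

definition flip_W :: "'k \<times> 'h::uminus \<Rightarrow> 'h \<times> 'k" where
  "flip_W = (\<lambda>(k, h). (- h, k))"

definition op_M :: "('h::minus \<rightharpoonup> 'k::plus) \<Rightarrow> ('k \<rightharpoonup> 'h) \<Rightarrow> ('h \<times> 'k \<rightharpoonup> 'h \<times> 'k)" where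
  "op_M S T = (\<lambda>(h, k).
     if h \<in> dom S \<and> k \<in> dom T then Some (h - the (T k), the (S h) + k) else None)"

end

theory Submission
  imports Defs
begin

text \<open>
  A pair \<open>(-g, k)\<close> is orthogonal to \<open>G(S)\<close> iff \<open>(Sh | k) = (h | g)\<close> for all \<open>h\<close> in
  \<open>dom S\<close>. So for densely defined \<open>S\<close> the equations \<open>S\<^sup>* = T\<close> and
  \<open>G(S)\<^sup>\<bottom> = W\<langle>G(T)\<rangle>\<close> say the same, and the latter forces \<open>dom S\<close> to be dense: a vector
  \<open>x\<close> orthogonal to \<open>dom S\<close> gives \<open>(x, 0)\<close> in \<open>W\<langle>G(T)\<rangle>\<close>, hence \<open>x = -T0 = 0\<close>.
  If \<open>S\<close> and \<open>T\<close> are adjoint to each other, then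
  \<open>M (h, k) = (h, Sh) + W (k, Tk)\<close> with \<open>W (k, Tk)\<close> orthogonal to \<open>G(S)\<close>, so \<open>M (h, k)\<close> can only
  be orthogonal to \<open>G(S)\<close> if \<open>(h, Sh) = 0\<close>.
\<close>

section \<open>Algebra of the conjugation and of the inner product\<close>

lemma scnj_0 [simp]: "scnj (0::'a::rc_scalar) = 0"
  using scnj_of_real[of 0, where 'a='a] by simp

lemma scnj_minus [simp]: "scnj (- x) = - scnj x" for x :: "'a::rc_scalar"
  using scnj_add[of x "- x"] by (simp add: eq_neg_iff_add_eq_0 add.commute)

lemma scnj_eq_iff [simp]: "scnj x = scnj y \<longleftrightarrow> x = y" for x y :: "'a::rc_scalar"
  by (metis scnj_scnj)

context inner_product_space
begin

lemma ip_zero_left [simp]: "ip 0 x = 0"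
  using ip_add_left[of 0 0 x] by simp

lemma ip_zero_right [simp]: "ip x 0 = 0"
  using ip_commute[of x 0] by simp

lemma ip_minus_left [simp]: "ip (- x) y = - ip x y"
  using ip_add_left[of x "- x" y] by (simp add: eq_neg_iff_add_eq_0 add.commute)

lemma ip_minus_right [simp]: "ip x (- y) = - ip x y"
  by (metis ip_commute ip_minus_left scnj_minus)

lemma ip_add_right: "ip x (y + z) = ip x y + ip x z"
  by (metis ip_commute ip_add_left scnj_add)

lemma ip_scale_right: "ip x (scale c y) = scnj c * ip x y"
  by (metis ip_commute ip_scale_left scnj_mult)

lemma ip_diff_left: "ip (x - y) z = ip x z - ip y z"
  using ip_add_left[of x "- y" z] by simp

lemma ip_diff_right: "ip z (x - y) = ip z x - ip z y"
  using ip_add_right[of z x "- y"] by simp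

lemma ip_eq_0_commute: "ip x y = 0 \<longleftrightarrow> ip y x = 0"
  by (metis ip_commute scnj_0)

section \<open>Norm identities, and orthogonality from minimality\<close>

lemma parallelogram_law:
  "(norm (x + y))\<^sup>2 + (norm (x - y))\<^sup>2 = 2 * (norm x)\<^sup>2 + 2 * (norm y)\<^sup>2"
  for x y :: 'h
proof -
  have "ip (x + y) (x + y) + ip (x - y) (x - y) = 2 * ip x x + 2 * ip y y"
    by (simp add: ip_add_left ip_add_right ip_diff_left ip_diff_right)
  \<comment> \<open>The identity is computed among scalars; injectivity of \<open>of_real\<close>
    carries it back to real norms.\<close>
  then have "of_real ((norm (x + y))\<^sup>2 + (norm (x - y))\<^sup>2)
    = (of_real (2 * (norm x)\<^sup>2 + 2 * (norm y)\<^sup>2) :: 's)"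
    unfolding ip_self by simp
  then show ?thesis
    by (simp only: of_real_eq_iff)
qed

lemma pythagoras_diff:
  assumes "ip x y = 0"
  shows "(norm (x - y))\<^sup>2 = (norm x)\<^sup>2 + (norm y)\<^sup>2"
proof -
  have "ip y x = 0"
    using assms ip_eq_0_commute by blast
  then have "ip (x - y) (x - y) = ip x x + ip y y"
    using assms by (simp add: ip_diff_left ip_diff_right)
  then have "of_real ((norm (x - y))\<^sup>2) = (of_real ((norm x)\<^sup>2 + (norm y)\<^sup>2) :: 's)"
    unfolding ip_self by simp
  then show ?thesis
    by (simp only: of_real_eq_iff)
qed

text \<open>The coefficient contains \<open>ip u v\<close> so that the cross terms become real
  multiples of \<open>ip u v * scnj (ip u v)\<close>, whichever the scalar field is.\<close>

lemma norm_diff_scale_ip: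
  "(norm (u - scale (of_real t * ip u v) v))\<^sup>2
    = (norm u)\<^sup>2 - 2 * t * (norm (ip u v))\<^sup>2 + t\<^sup>2 * (norm (ip u v))\<^sup>2 * (norm v)\<^sup>2"
proof -
  define a where "a = ip u v"
  have aa: "a * scnj a = of_real ((norm a)\<^sup>2)"
    by (rule mult_scnj_self)
  have "ip v u = scnj a"
    by (simp add: a_def ip_commute[symmetric])
  then have "ip (u - scale (of_real t * a) v) (u - scale (of_real t * a) v)
     = ip u u - 2 * of_real t * (a * scnj a) + (of_real t)\<^sup>2 * (a * scnj a) * ip v v"
    by (simp add: ip_diff_left ip_diff_right ip_scale_left ip_scale_right scnj_mult scnj_of_real
        a_def[symmetric] algebra_simps power2_eq_square)
  then have "of_real ((norm (u - scale (of_real t * a) v))\<^sup>2)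
     = (of_real ((norm u)\<^sup>2 - 2 * t * (norm a)\<^sup>2 + t\<^sup>2 * (norm a)\<^sup>2 * (norm v)\<^sup>2) :: 's)"
    unfolding ip_self aa by simp
  then show ?thesis
    unfolding a_def by (simp only: of_real_eq_iff)
qed

text \<open>Moving from \<open>u\<close> a small way along \<open>ip u v\<close> times
  \<open>v\<close> lowers the squared norm to first order, and the second-order term cannot
  compensate.\<close>

lemma ip_eq_0_if_norm_minimal:
  assumes "\<And>c. norm u \<le> norm (u - scale c v)"
  shows "ip u v = 0"
proof (rule ccontr)
  assume "ip u v \<noteq> 0"
  then have a: "(norm (ip u v))\<^sup>2 > 0"
    by simp
  \<comment> \<open>This choice forces \<open>t * (norm v)\<^sup>2 < 1\<close>, so the quadratic
    term stays below the linear one; the added 1 also covers \<open>v = 0\<close>.\<close>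
  define t where "t = 1 / ((norm v)\<^sup>2 + 1)"
  have pos: "(norm v)\<^sup>2 + 1 > 0"
    by (simp add: add_nonneg_pos)
  have t: "t > 0" "t * (norm v)\<^sup>2 < 1"
    using pos by (simp_all add: t_def)
  have "(norm u)\<^sup>2 \<le> (norm (u - scale (of_real t * ip u v) v))\<^sup>2"
    using assms by (simp add: power_mono)
  then have "(2 * t) * (norm (ip u v))\<^sup>2 \<le> (t * (t * (norm v)\<^sup>2)) * (norm (ip u v))\<^sup>2"
    unfolding norm_diff_scale_ip by (simp add: power2_eq_square algebra_simps)
  then have "2 * t \<le> t * (t * (norm v)\<^sup>2)"
    using a mult_le_cancel_right_pos by blast
  also have "\<dots> < t * 1"
    using t by (intro mult_strict_left_mono)
  finally show False
    using t by simp
qed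

text \<open>By Pythagoras, a vector \<open>x\<close> orthogonal to \<open>V\<close> is at distance
  at least \<open>norm x\<close> from every point of \<open>V\<close>, which density excludes unless
  \<open>x = 0\<close>.\<close>

lemma orth_compl_dense:
  assumes "closure V = UNIV"
  shows "orth_compl ip V = {0}"
proof -
  have "x = 0" if "\<forall>v\<in>V. ip x v = 0" for x
  proof (rule ccontr)
    assume "x \<noteq> 0"
    then obtain v where v: "v \<in> V" "dist v x < norm x"
      using assms by (metis UNIV_I closure_approachable zero_less_norm_iff)
    then have "(norm x)\<^sup>2 \<le> (norm (x - v))\<^sup>2"
      using that pythagoras_diff[of x v] by simp
    then show False
      using v power2_le_imp_le by (fastforce simp: dist_norm norm_minus_commute)
  qed
  then show ?thesis
    by (auto simp: orth_compl_def)
qed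

end

section \<open>Closest points and density of subspaces\<close>

lemma (in hilbert_space) subspace_has_closest_point:
  assumes V: "subspace V"
  obtains p where "p \<in> closure V" "\<And>v. v \<in> V \<Longrightarrow> norm (x - p) \<le> norm (x - v)"
proof -
  have ne: "V \<noteq> {}"
    using subspace_0[OF V] by auto
  \<comment> \<open>A sequence in \<open>V\<close> whose distances to \<open>x\<close> tend to the
    infimum \<open>d\<close> is shown to be Cauchy. Its limit exists by completeness, but lies only
    in \<open>closure V\<close>.\<close>
  define d where "d = infdist x V"
  have d0: "d \<ge> 0"
    by (simp add: d_def infdist_nonneg)
  have dle: "d \<le> norm (x - v)" if "v \<in> V" for v
    using infdist_le[OF that, of x] by (simp add: d_def dist_norm)
  have "\<exists>v\<in>V. norm (x - v) < d + 1 / real (Suc n)" for n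
  proof (rule ccontr)
    assume "\<not> ?thesis"
    then have "d + 1 / real (Suc n) \<le> infdist x V"
      unfolding infdist_notempty[OF ne] using ne
      by (intro cINF_greatest) (auto simp: dist_norm not_less)
    then show False
      by (simp add: d_def)
  qed
  then obtain s where sV: "\<And>n. s n \<in> V"
    and s: "\<And>n. norm (x - s n) < d + 1 / real (Suc n)"
    by metis
  have s_lim: "(\<lambda>n. norm (x - s n)) \<longlonglongrightarrow> d"
  proof (rule tendsto_sandwich[where f = "\<lambda>_. d" and h = "\<lambda>n. d + 1 / real (Suc n)"])
    show "(\<lambda>n. d + 1 / real (Suc n)) \<longlonglongrightarrow> d"
      using tendsto_add[OF tendsto_const[of d] LIMSEQ_Suc[OF lim_1_over_n]] by simp
  qed (use dle sV s in \<open>auto intro!: always_eventually less_imp_le\<close>)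
  have dist_s: "(norm (s m - s n))\<^sup>2
      \<le> 2 * ((norm (x - s m))\<^sup>2 - d\<^sup>2) + 2 * ((norm (x - s n))\<^sup>2 - d\<^sup>2)" for m n
  proof -
    \<comment> \<open>The midpoint of \<open>s m\<close> and \<open>s n\<close> lies in
      \<open>V\<close>, hence at distance at least \<open>d\<close> from \<open>x\<close>; the
      parallelogram law then bounds \<open>norm (s m - s n)\<close>.\<close>
    define w where "w = scale (of_real (1/2)) (s m + s n)"
    have "w \<in> V"
      unfolding w_def by (intro subspace_scale subspace_add V sV)
    then have "d\<^sup>2 \<le> (norm (x - w))\<^sup>2"
      using dle d0 by (simp add: power_mono)
    moreover have "(x - s m) + (x - s n) = 2 *\<^sub>R (x - w)"
      unfolding w_def scale_of_real by (simp add: scaleR_diff_right scaleR_2)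
    then have "(norm ((x - s m) + (x - s n)))\<^sup>2 = 4 * (norm (x - w))\<^sup>2"
      by (simp add: power_mult_distrib)
    ultimately show ?thesis
      using parallelogram_law[of "x - s m" "x - s n"] by (simp add: norm_minus_commute)
  qed
  have "Cauchy s"
  proof (rule metric_CauchyI)
    fix e :: real
    assume e: "e > 0"
    have "(\<lambda>n. (norm (x - s n))\<^sup>2 - d\<^sup>2) \<longlonglongrightarrow> d\<^sup>2 - d\<^sup>2"
      by (intro tendsto_intros s_lim)
    then have "eventually (\<lambda>n. (norm (x - s n))\<^sup>2 - d\<^sup>2 < e\<^sup>2 / 4) sequentially"
      by (rule order_tendstoD) (use e in simp)
    then obtain N where N: "\<And>n. n \<ge> N \<Longrightarrow> (norm (x - s n))\<^sup>2 - d\<^sup>2 < e\<^sup>2 / 4"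
      by (auto simp: eventually_sequentially)
    have "dist (s m) (s n) < e" if "m \<ge> N" "n \<ge> N" for m n
    proof (rule power2_less_imp_less)
      show "(dist (s m) (s n))\<^sup>2 < e\<^sup>2"
        using dist_s[of m n] N[OF that(1)] N[OF that(2)] by (simp add: dist_norm)
    qed (use e in simp)
    then show "\<exists>M. \<forall>m\<ge>M. \<forall>n\<ge>M. dist (s m) (s n) < e"
      by blast
  qed
  then obtain p where p: "s \<longlonglongrightarrow> p"
    using complete_UNIV unfolding complete_def by auto
  have "(\<lambda>n. norm (x - s n)) \<longlonglongrightarrow> norm (x - p)"
    by (intro tendsto_intros p)
  then have "norm (x - p) = d"
    using s_lim LIMSEQ_unique by blast
  then show ?thesis
    using that p sV dle closure_sequential by metis
qed

text \<open>For \<open>p\<close> in \<open>closure V\<close> closest to \<open>x\<close>, minimality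
  makes \<open>x - p\<close> orthogonal to \<open>V\<close>, so \<open>x = p\<close>.\<close>

lemma (in hilbert_space) closure_eq_UNIV_if_orth_compl:
  assumes V: "subspace V" and orth: "orth_compl ip V = {0}"
  shows "closure V = UNIV"
proof -
  have "x \<in> closure V" for x
  proof -
    obtain p where p: "p \<in> closure V" "\<And>v. v \<in> V \<Longrightarrow> norm (x - p) \<le> norm (x - v)"
      using subspace_has_closest_point[OF V] by blast
    have "ip (x - p) v = 0" if v: "v \<in> V" for v
    proof (rule ip_eq_0_if_norm_minimal)
      fix c
      \<comment> \<open>Minimality is known only against points of \<open>V\<close>, so
        \<open>p + scale c v\<close> is reached as the limit of
        \<open>s n + scale c v\<close>.\<close>
      obtain s where s: "\<And>n. s n \<in> V" "s \<longlonglongrightarrow> p"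
        using p(1) closure_sequential by blast
      have "norm (x - p) \<le> norm (x - (s n + scale c v))" for n
        by (intro p(2) subspace_add subspace_scale V s v)
      moreover have "(\<lambda>n. norm (x - (s n + scale c v))) \<longlonglongrightarrow> norm (x - (p + scale c v))"
        by (intro tendsto_intros s)
      ultimately have "norm (x - p) \<le> norm (x - (p + scale c v))"
        by (intro Lim_bounded2) auto
      then show "norm (x - p) \<le> norm (x - p - scale c v)"
        by (simp add: diff_diff_eq)
    qed
    then have "x - p \<in> orth_compl ip V"
      by (simp add: orth_compl_def)
    then show ?thesis
      using orth p(1) by simp
  qed
  then show ?thesis
    by blast
qed

section \<open>Graphs, adjoints and the operator \<open>M\<close>\<close>

lemma linear_operator_zero:
  assumes "vector_space scH" "vector_space scK" "linear_operator scH scK S"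
  shows "S 0 = Some 0"
proof -
  interpret H: vector_space scH by fact
  interpret K: vector_space scK by fact
  have "0 \<in> dom S"
    using assms(3) H.subspace_0 by (auto simp: linear_operator_def)
  moreover from this have "the (S (scH 0 0)) = scK 0 (the (S 0))"
    using assms(3) unfolding linear_operator_def by blast
  ultimately show ?thesis
    by auto
qed

lemma mem_orth_compl_graph_iff:
  assumes "inner_product_space scH ipH" "inner_product_space scK ipK"
  shows "(- g, k) \<in> orth_compl (prod_ip ipH ipK) (Map.graph S)
    \<longleftrightarrow> (\<forall>h\<in>dom S. ipK (the (S h)) k = ipH h g)"
proof -
  interpret H: inner_product_space scH ipH by fact
  interpret K: inner_product_space scK ipK by fact
  have "ipH (- g) h + ipK k y = 0 \<longleftrightarrow> ipK y k = ipH h g" for h y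
    using add_eq_0_iff[of "- ipH g h" "ipK k y"]
    by (simp add: H.ip_commute[of h g] K.ip_commute[of y k])
  then show ?thesis
    by (auto simp: orth_compl_def Map.graph_def prod_ip_def dom_def)
qed

lemma mem_flip_W_graph_iff:
  "(- g, k) \<in> flip_W ` Map.graph T \<longleftrightarrow> T k = Some g" for g :: "'h::group_add"
  by (force simp: flip_W_def Map.graph_def image_iff)

text \<open>Negation is a bijection, so sets of pairs may be compared in the form
  \<open>(- g, k)\<close> that the two membership criteria above use.\<close>

lemma set_eq_iff_uminus_fst:
  "A = B \<longleftrightarrow> (\<forall>k g. (- g, k) \<in> A \<longleftrightarrow> (- g, k) \<in> B)" for A B :: "('h::group_add \<times> 'k) set"
  by (metis minus_minus set_eqI surj_pair)

text \<open>Two representing vectors differ by an element of the trivial complement of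
  \<open>dom S\<close>, so the description by \<open>THE\<close> is unambiguous.\<close>

lemma op_adjoint_eq_Some_iff:
  assumes "inner_product_space scH ipH" and "orth_compl ipH (dom S) = {0}"
  shows "op_adjoint ipH ipK S k = Some g \<longleftrightarrow> (\<forall>h\<in>dom S. ipK (the (S h)) k = ipH h g)"
proof -
  interpret H: inner_product_space scH ipH by fact
  have unique: "g = g'"
    if g: "\<forall>h\<in>dom S. ipK (the (S h)) k = ipH h g"
      and g': "\<forall>h\<in>dom S. ipK (the (S h)) k = ipH h g'" for g g'
  proof -
    have "ipH h (g - g') = 0" if "h \<in> dom S" for h
      using bspec[OF g that] bspec[OF g' that] H.ip_diff_right[of h g g'] by simp
    then have "g - g' \<in> orth_compl ipH (dom S)"
      using H.ip_eq_0_commute by (auto simp: orth_compl_def)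
    then show ?thesis
      using assms(2) by simp
  qed
  have the_eq: "(THE g. \<forall>h\<in>dom S. ipK (the (S h)) k = ipH h g) = g"
    if "\<forall>h\<in>dom S. ipK (the (S h)) k = ipH h g" for g
    using that unique by (intro the_equality) blast+
  show ?thesis
  proof
    assume "op_adjoint ipH ipK S k = Some g"
    then obtain g' where "\<forall>h\<in>dom S. ipK (the (S h)) k = ipH h g'"
      and "(THE g. \<forall>h\<in>dom S. ipK (the (S h)) k = ipH h g) = g"
      unfolding op_adjoint_def by (auto split: if_splits)
    then show "\<forall>h\<in>dom S. ipK (the (S h)) k = ipH h g"
      using the_eq by simp
  next
    assume g: "\<forall>h\<in>dom S. ipK (the (S h)) k = ipH h g"
    then show "op_adjoint ipH ipK S k = Some g"
      unfolding op_adjoint_def the_eq[OF g] by auto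
  qed
qed

lemma op_adjoint_eq_iff_orth_compl_graph:
  assumes "inner_product_space scH ipH" "inner_product_space scK ipK"
    and "orth_compl ipH (dom S) = {0}"
  shows "op_adjoint ipH ipK S = T
    \<longleftrightarrow> orth_compl (prod_ip ipH ipK) (Map.graph S) = flip_W ` Map.graph T"
proof -
  have fun_eq: "A = T \<longleftrightarrow> (\<forall>k g. A k = Some g \<longleftrightarrow> T k = Some g)" for A
  proof
    assume eq: "\<forall>k g. A k = Some g \<longleftrightarrow> T k = Some g"
    have "A k = T k" for k
      using eq[rule_format, of k "the (A k)"] eq[rule_format, of k "the (T k)"]
      by (cases "A k"; cases "T k") auto
    then show "A = T"
      by (rule ext)
  qed simp
  show ?thesis
    unfolding fun_eq[of "op_adjoint ipH ipK S"] set_eq_iff_uminus_fst mem_flip_W_graph_iff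
      mem_orth_compl_graph_iff[OF assms(1,2)] op_adjoint_eq_Some_iff[OF assms(1,3)]
    by (rule refl)
qed

text \<open>Adjointness is the orthogonality criterion for \<open>(- g, k)\<close> at
  \<open>g = the (T k)\<close>, hence one half of the set equality in (ii).\<close>

lemma adjoint_pair_iff_flip_W_graph_subset:
  assumes "inner_product_space scH ipH" "inner_product_space scK ipK"
  shows "adjoint_pair ipH ipK S T
    \<longleftrightarrow> flip_W ` Map.graph T \<subseteq> orth_compl (prod_ip ipH ipK) (Map.graph S)"
proof -
  have "flip_W ` Map.graph T = (\<lambda>k. (- the (T k), k)) ` dom T"
    unfolding graph_eq_to_snd_dom by (simp add: flip_W_def image_image)
  then show ?thesis
    unfolding adjoint_pair_def
    by (simp only: image_subset_iff mem_orth_compl_graph_iff[OF assms]) blast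
qed

lemma orth_compl_dom_subset:
  assumes "inner_product_space scH ipH" "inner_product_space scK ipK"
    and "x \<in> orth_compl ipH (dom S)"
  shows "(x, 0) \<in> orth_compl (prod_ip ipH ipK) (Map.graph S)"
proof -
  interpret K: inner_product_space scK ipK by fact
  show ?thesis
    using assms(3) by (auto simp: orth_compl_def Map.graph_def prod_ip_def dom_def)
qed

lemma orth_compl_graph_eq_iff_subset_ran_op_M:
  fixes ipH :: "'h::real_normed_vector \<Rightarrow> 'h \<Rightarrow> 's::rc_scalar"
  assumes "inner_product_space scH ipH" "inner_product_space scK ipK"
    and S0: "S 0 = Some 0" and adj: "adjoint_pair ipH ipK S T"
  shows "orth_compl (prod_ip ipH ipK) (Map.graph S) = flip_W ` Map.graph T
    \<longleftrightarrow> orth_compl (prod_ip ipH ipK) (Map.graph S) \<subseteq> ran (op_M S T)"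
proof
  interpret H: inner_product_space scH ipH by fact
  interpret K: inner_product_space scK ipK by fact
  let ?X = "orth_compl (prod_ip ipH ipK) (Map.graph S)"
  have sub: "flip_W ` Map.graph T \<subseteq> ?X"
    using adj adjoint_pair_iff_flip_W_graph_subset[OF assms(1,2)] by blast
  {
    assume "?X = flip_W ` Map.graph T"
    moreover have "flip_W (k, g) \<in> ran (op_M S T)" if "T k = Some g" for k g
    proof -
      \<comment> \<open>Since \<open>S 0 = 0\<close>, the operator \<open>M\<close> acts on pairs
        \<open>(0, k)\<close> as the flip of the graph of \<open>T\<close>.\<close>
      have "op_M S T (0, k) = Some (flip_W (k, g))"
        using that S0 by (auto simp: op_M_def flip_W_def)
      then show ?thesis
        by (rule ranI)
    qed
    ultimately show "?X \<subseteq> ran (op_M S T)"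
      by (auto simp: Map.graph_def)
  }
  assume ran: "?X \<subseteq> ran (op_M S T)"
  have "z \<in> flip_W ` Map.graph T" if z: "z \<in> ?X" for z
  proof -
    obtain h k where "op_M S T (h, k) = Some z"
      using z ran by (fastforce simp: ran_def)
    then obtain y g where S: "S h = Some y" and T: "T k = Some g" and z_eq: "z = (h - g, y + k)"
      by (auto simp: op_M_def split: if_splits)
    have hy: "(h, y) \<in> Map.graph S"
      using S by (simp add: Map.graph_def)
    have Wk: "(- g, k) \<in> flip_W ` Map.graph T"
      using T by (simp add: mem_flip_W_graph_iff)
    then have "(- g, k) \<in> ?X"
      using sub by blast
    \<comment> \<open>Pairing \<open>z\<close> with the graph element \<open>(h, y)\<close> kills
      the flipped part and leaves the squared norm of \<open>(h, y)\<close>, which must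
      vanish.\<close>
    then have "- ipH g h + ipK k y = 0"
      using hy by (auto simp: orth_compl_def prod_ip_def)
    moreover have "ipH (h - g) h + ipK (y + k) y = 0"
      using z hy z_eq by (auto simp: orth_compl_def prod_ip_def)
    moreover have "ipH (h - g) h + ipK (y + k) y
        = (ipH h h + ipK y y) + (- ipH g h + ipK k y)"
      by (simp add: H.ip_diff_left K.ip_add_left)
    ultimately have "ipH h h + ipK y y = 0"
      by simp
    then have "of_real ((norm h)\<^sup>2 + (norm y)\<^sup>2) = (of_real 0 :: 's)"
      unfolding H.ip_self K.ip_self by simp
    then have "(norm h)\<^sup>2 + (norm y)\<^sup>2 = 0"
      by (simp only: of_real_eq_iff)
    then have "h = 0" "y = 0"
      by (simp_all add: sum_power2_eq_zero_iff)
    then show ?thesis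
      using Wk z_eq by simp
  qed
  then show "?X = flip_W ` Map.graph T"
    using sub by blast
qed

theorem theorem2p2:
  fixes scH :: "'s::rc_scalar \<Rightarrow> 'h::real_normed_vector \<Rightarrow> 'h"
    and ipH :: "'h \<Rightarrow> 'h \<Rightarrow> 's"
    and scK :: "'s \<Rightarrow> 'k::real_normed_vector \<Rightarrow> 'k"
    and ipK :: "'k \<Rightarrow> 'k \<Rightarrow> 's"
    and S :: "'h \<rightharpoonup> 'k"
    and T :: "'k \<rightharpoonup> 'h"
  assumes "hilbert_space scH ipH"
    and "hilbert_space scK ipK"
    and "linear_operator scH scK S"
    and "linear_operator scK scH T"
  shows "((densely_defined S \<and> op_adjoint ipH ipK S = T) \<longleftrightarrow>
          (adjoint_pair ipH ipK S T \<and>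
            orth_compl (prod_ip ipH ipK) (Map.graph S) = flip_W ` Map.graph T))
       \<and> ((adjoint_pair ipH ipK S T \<and>
            orth_compl (prod_ip ipH ipK) (Map.graph S) = flip_W ` Map.graph T) \<longleftrightarrow>
          (adjoint_pair ipH ipK S T \<and>
            orth_compl (prod_ip ipH ipK) (Map.graph S) \<subseteq> ran (op_M S T)))"
proof -
  interpret H: hilbert_space scH ipH by fact
  interpret K: hilbert_space scK ipK by fact
  note ips = H.inner_product_space_axioms K.inner_product_space_axioms
  let ?X = "orth_compl (prod_ip ipH ipK) (Map.graph S)"
  let ?Y = "flip_W ` Map.graph T"
  have S0: "S 0 = Some 0"
    using linear_operator_zero[OF H.vector_space_axioms K.vector_space_axioms assms(3)] .
  have T0: "T 0 = Some 0"
    using linear_operator_zero[OF K.vector_space_axioms H.vector_space_axioms assms(4)] .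
  \<comment> \<open>The implication to density uses that \<open>dom S\<close> is a subspace of a
    complete space.\<close>
  have dense_iff: "densely_defined S \<longleftrightarrow> orth_compl ipH (dom S) = {0}"
    using assms(3) H.closure_eq_UNIV_if_orth_compl H.orth_compl_dense
    by (auto simp: densely_defined_def linear_operator_def)
  have dense: "orth_compl ipH (dom S) = {0}" if XY: "?X = ?Y"
  proof -
    have "x = 0" if "x \<in> orth_compl ipH (dom S)" for x
    proof -
      \<comment> \<open>The double negation fits the criterion for the flipped graph, which yields
        \<open>T 0 = Some (- x)\<close>.\<close>
      have "(- (- x), 0) \<in> ?Y"
        using orth_compl_dom_subset[OF ips that] XY by simp
      then show ?thesis
        unfolding mem_flip_W_graph_iff using T0 by simp
    qed
    then show ?thesis
      by (auto simp: orth_compl_def)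
  qed
  \<comment> \<open>Adjointness is absent here because the equality of the two sets already contains
    the inclusion expressing it.\<close>
  have "densely_defined S \<and> op_adjoint ipH ipK S = T \<longleftrightarrow> ?X = ?Y"
    using dense dense_iff op_adjoint_eq_iff_orth_compl_graph[OF ips] by metis
  moreover have "adjoint_pair ipH ipK S T" if "?X = ?Y"
    using that adjoint_pair_iff_flip_W_graph_subset[OF ips] by blast
  ultimately show ?thesis
    using orth_compl_graph_eq_iff_subset_ran_op_M[of scH ipH scK ipK S T, OF ips S0] by blast
qed

end
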